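(* For each positive integer $n$ let $Q_n(\theta)=\prod_{k=1}^n(1+e^{ik\theta})$, $\theta\in\mathbb{R}/2\pi\mathbb{Z}$, with Fourier coefficients $\widehat{Q_n}(j)=\frac{1}{2\pi}\int_0^{2\pi}Q_n(\theta)e^{-ij\theta}\,d\theta$ for $j\in\mathbb{Z}$, and let $\|\widehat{Q_n}\|_\infty=\sup_{j\in\mathbb{Z}}|\widehat{Q_n}(j)|$. Then, as $n\to\infty$, $$\|\widehat{Q_n}\|_\infty\sim 2^n\sqrt{\frac{6}{\pi}}\;n^{-3/2}.$$
   Context: The notation $a_n\sim b_n$ means $a_n/b_n\to1$ as $n\to\infty$. *)

theory Defs
  imports "HOL-Analysis.Analysis" "HOL-Library.Landau_Symbols"
begin

(* Functions on R / 2 pi Z are represented by their 2 pi-periodic lifts to the reals. *)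

definition Q :: "nat \<Rightarrow> real \<Rightarrow> complex" where
  "Q n \<theta> = (\<Prod>k=1..n. 1 + exp (\<i> * of_nat k * of_real \<theta>))"

definition fourier_coeff :: "(real \<Rightarrow> complex) \<Rightarrow> int \<Rightarrow> complex" where
  "fourier_coeff f j =
     1 / (2 * of_real pi) * integral {0..2 * pi} (\<lambda>\<theta>. f \<theta> * exp (- (\<i> * of_int j * of_real \<theta>)))"

(* The supremum is taken in the reals, so this is meaningful only for bounded c;
   see bdd_above_fourier_coeff_Q for the sequences it is applied to. *)
definition sup_norm :: "(int \<Rightarrow> complex) \<Rightarrow> real" where
  "sup_norm c = (SUP j. norm (c j))"

lemma Q_periodic: "Q n (\<theta> + 2 * pi) = Q n \<theta>"
proof -
  have "exp (\<i> * of_nat k * of_real (\<theta> + 2 * pi)) = exp (\<i> * of_nat k * of_real \<theta>)" for k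
  proof -
    have "\<i> * of_nat k * of_real (\<theta> + 2 * pi)
        = \<i> * of_nat k * of_real \<theta> + of_real (of_int (2 * int k) * pi) * \<i>"
      by (simp add: algebra_simps)
    then show ?thesis
      unfolding exp_eq by blast
  qed
  then show ?thesis
    unfolding Q_def by simp
qed

lemma norm_Q_le: "norm (Q n \<theta>) \<le> 2 ^ n"
proof -
  have "norm (1 + exp (\<i> * of_nat k * of_real \<theta>)) \<le> 2" for k
    using norm_triangle_ineq[of 1 "exp (\<i> * of_nat k * of_real \<theta>)"] by simp
  then have "norm (Q n \<theta>) \<le> (\<Prod>k=1..n. 2)"
    unfolding Q_def prod_norm[symmetric] by (intro prod_mono) auto
  then show ?thesis by simp
qed

lemma continuous_on_Q: "continuous_on S (Q n)"
  unfolding Q_def[abs_def] by (intro continuous_intros)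

lemma bdd_above_fourier_coeff_Q: "bdd_above (range (\<lambda>j. norm (fourier_coeff (Q n) j)))"
proof (rule bdd_aboveI2)
  fix j :: int
  have "norm (integral {0..2 * pi} (\<lambda>\<theta>. Q n \<theta> * exp (- (\<i> * of_int j * of_real \<theta>))))
      \<le> 2 ^ n * (2 * pi - 0)"
    by (rule integral_bound)
      (auto intro!: continuous_intros continuous_on_Q simp: norm_mult norm_Q_le)
  then show "norm (fourier_coeff (Q n) j) \<le> 2 ^ n"
    unfolding fourier_coeff_def by (simp add: norm_mult norm_divide field_simps)
qed

end

theory Submission
  imports Defs "HOL-Probability.Sinc_Integral" "HOL-Real_Asymp.Real_Asymp"
begin

text \<open>
  Taking half of each phase out of \<open>1 + e\<^sup>i\<^sup>k\<^sup>\<theta> = 2 cos (k\<theta>/2) e\<^sup>i\<^sup>k\<^sup>\<theta>\<^sup>/\<^sup>2\<close> writes \<open>Q\<close> as \<open>2\<^sup>n\<close> times the real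
  product \<open>\<Prod> cos (k\<theta>/2)\<close> times the phase of frequency \<open>n(n+1)/4\<close>. Hence every Fourier coefficient
  is at most \<open>2\<^sup>n/(2\<pi>) \<integral> |\<Prod> cos (k\<theta>/2)|\<close> over \<open>[-\<pi>, \<pi>]\<close> in absolute value, while the coefficient
  whose index is \<open>n(n+1)/4\<close> rounded down almost loses its phase: it is at least
  \<open>2\<^sup>n/(2\<pi>) \<integral> \<Prod> cos (k\<theta>/2) cos (\<delta>\<theta>)\<close> with \<open>0 \<le> \<delta> < 1\<close>. The proof shows that the two bounds are
  asymptotically equal.

  In probabilistic terms this is a local limit theorem for a sum of independent variables that are
  \<open>0\<close> or \<open>k\<close> with probability one half each, for \<open>k \<le> n\<close>. The variance is \<open>\<Sum> k\<^sup>2/4 \<sim> n\<^sup>3/12\<close>, so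
  the natural scale is \<open>\<theta> = t n\<close> to the power \<open>-3/2\<close>. On that scale the product tends to
  \<open>exp (-t\<^sup>2/24)\<close> (\<open>cos_prod_tendsto\<close>), and the shift \<open>\<delta>\<close> disappears. To pass to the limit under
  the integral one needs a majorant valid on all of \<open>[-\<pi>, \<pi>]\<close>. It comes from
  \<open>|cos x| \<le> exp (-sin\<^sup>2 x / 2)\<close>: the sum of \<open>sin\<^sup>2 (k\<theta>/2)\<close> is of order \<open>n\<^sup>3\<theta>\<^sup>2\<close> as long as
  \<open>n|\<theta>| \<le> \<pi>\<close>, and of order \<open>n\<close> for larger \<open>|\<theta>|\<close>. Both regimes together give a bound by a constant
  multiple of \<open>1/(1 + n\<^sup>3\<theta>\<^sup>2)\<close> (\<open>abs_cos_prod_le\<close>), which is \<open>1/(1 + t\<^sup>2)\<close> after rescaling.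
  Dominated convergence (\<open>rescaled_integral_tendsto\<close>) then yields the Gaussian integral
  \<open>\<integral> exp (-t\<^sup>2/24) = sqrt (24 \<pi>)\<close> for both bounds, and \<open>sqrt (24 \<pi>) / (2 \<pi>) = sqrt (6/\<pi>)\<close>.
\<close>

section \<open>Factorisation into cosines\<close>

definition cos_prod :: "nat \<Rightarrow> real \<Rightarrow> real" where
  "cos_prod n \<theta> = (\<Prod>k=1..n. cos (real k * \<theta> / 2))"

lemma continuous_on_cos_prod [continuous_intros]: "continuous_on S (cos_prod n)"
  unfolding cos_prod_def[abs_def] by (intro continuous_intros) auto

lemma Q_eq_cos_prod:
  "Q n \<theta> = of_real (2 ^ n * cos_prod n \<theta>) * cis (real (n * (n + 1)) / 4 * \<theta>)"
proof -
  have factor: "1 + exp (\<i> * of_nat k * of_real \<theta>)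
      = of_real (2 * cos (real k * \<theta> / 2)) * cis (real k * \<theta> / 2)" for k
  proof -
    define x where "x = real k * \<theta> / 2"
    have "exp (\<i> * of_nat k * of_real \<theta>) = cis (2 * x)"
      unfolding cis_conv_exp x_def by (simp add: mult.assoc)
    moreover have "1 + cis (2 * x) = of_real (2 * cos x) * cis x"
      by (simp add: complex_eq_iff cos_double_cos sin_double power2_eq_square)
    ultimately show ?thesis by (simp add: x_def)
  qed
  have "(\<Prod>k=1..n. cis (real k * \<theta> / 2)) = cis (real (n * (n + 1)) / 4 * \<theta>)"
  proof (induction n)
    case (Suc n)
    have arg: "real (n * (n + 1)) / 4 * \<theta> + real (Suc n) * \<theta> / 2 = real (Suc n * (Suc n + 1)) / 4 * \<theta>"
      by (simp add: field_simps)
    have "(\<Prod>k=1..Suc n. cis (real k * \<theta> / 2)) =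
        (\<Prod>k=1..n. cis (real k * \<theta> / 2)) * cis (real (Suc n) * \<theta> / 2)"
      by simp
    then show ?case unfolding Suc.IH cis_mult arg .
  qed simp
  then show ?thesis
    unfolding Q_def factor prod.distrib cos_prod_def by (simp add: prod.distrib)
qed

lemma integral_period:
  fixes f :: "real \<Rightarrow> complex"
  assumes "continuous_on UNIV f" and periodic: "\<And>x. f (x + 2 * pi) = f x"
  shows "integral {0..2 * pi} f = integral {- pi..pi} f"
proof -
  have int: "f integrable_on {a..b}" for a b
    by (rule integrable_continuous_interval) (rule continuous_on_subset[OF assms(1)], simp)
  have "integral {0..2 * pi} f = integral {0..pi} f + integral {pi..2 * pi} f"
    by (rule Henstock_Kurzweil_Integration.integral_combine[symmetric]) (auto intro: int)
  also have "integral {pi..2 * pi} f = integral {- pi..0} f"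
    using integral_shift_real_ivl[of pi "2 * pi" "2 * pi" f] by (simp add: periodic)
  also have "integral {0..pi} f + integral {- pi..0} f = integral {- pi..pi} f"
    using Henstock_Kurzweil_Integration.integral_combine[of "- pi" 0 pi f] by (simp add: int add.commute)
  finally show ?thesis .
qed

lemma fourier_coeff_Q:
  "fourier_coeff (Q n) j = of_real (2 ^ n / (2 * pi)) *
     integral {- pi..pi} (\<lambda>\<theta>. of_real (cos_prod n \<theta>) * cis ((real (n * (n + 1)) / 4 - of_int j) * \<theta>))"
proof -
  let ?f = "\<lambda>\<theta>. Q n \<theta> * exp (- (\<i> * of_int j * of_real \<theta>))"
  have periodic: "?f (\<theta> + 2 * pi) = ?f \<theta>" for \<theta>
  proof -
    have "exp (- (\<i> * of_int j * of_real (\<theta> + 2 * pi))) = exp (- (\<i> * of_int j * of_real \<theta>))"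
      unfolding exp_eq by (rule exI[of _ "- j"]) (simp add: algebra_simps)
    then show ?thesis by (simp only: Q_periodic)
  qed
  have shift: "integral {0..2 * pi} ?f = integral {- pi..pi} ?f"
    by (rule integral_period[where f = ?f, OF _ periodic]) (intro continuous_intros continuous_on_Q)
  have phase: "?f = (\<lambda>\<theta>. of_real (2 ^ n) * (of_real (cos_prod n \<theta>) *
                         cis ((real (n * (n + 1)) / 4 - of_int j) * \<theta>)))"
  proof
    fix \<theta>
    have "exp (- (\<i> * of_int j * of_real \<theta>)) = cis (- of_int j * \<theta>)"
      by (simp add: cis_conv_exp mult.assoc)
    moreover have "real (n * (n + 1)) / 4 * \<theta> + - of_int j * \<theta> = (real (n * (n + 1)) / 4 - of_int j) * \<theta>"
      by (simp add: left_diff_distrib)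
    ultimately show "?f \<theta> = of_real (2 ^ n) * (of_real (cos_prod n \<theta>) *
                         cis ((real (n * (n + 1)) / 4 - of_int j) * \<theta>))"
      by (simp only: Q_eq_cos_prod mult.assoc cis_mult of_real_mult)
  qed
  show ?thesis
    unfolding fourier_coeff_def shift unfolding phase by simp
qed

lemma norm_fourier_coeff_Q_le:
  "norm (fourier_coeff (Q n) j) \<le> 2 ^ n / (2 * pi) * integral {- pi..pi} (\<lambda>\<theta>. \<bar>cos_prod n \<theta>\<bar>)"
proof -
  let ?f = "\<lambda>\<theta>. of_real (cos_prod n \<theta>) * cis ((real (n * (n + 1)) / 4 - of_int j) * \<theta>)"
  have "norm (integral {- pi..pi} ?f) \<le> integral {- pi..pi} (\<lambda>\<theta>. \<bar>cos_prod n \<theta>\<bar>)"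
    by (rule integral_norm_bound_integral)
       (auto intro!: integrable_continuous_interval continuous_intros simp: norm_mult)
  then have "2 ^ n / (2 * pi) * norm (integral {- pi..pi} ?f)
      \<le> 2 ^ n / (2 * pi) * integral {- pi..pi} (\<lambda>\<theta>. \<bar>cos_prod n \<theta>\<bar>)"
    by (rule mult_left_mono) simp
  then show ?thesis
    unfolding fourier_coeff_Q norm_mult norm_of_real by simp
qed

text \<open>
  Only the real part of the coefficient is kept. Nothing is lost asymptotically when \<open>j\<close> is within a
  bounded distance of the mean \<open>n(n+1)/4\<close>, since the cosine is then close to \<open>1\<close> wherever the product
  is not negligible.
\<close>

lemma norm_fourier_coeff_Q_ge:
  "2 ^ n / (2 * pi) *
     integral {- pi..pi} (\<lambda>\<theta>. cos_prod n \<theta> * cos ((real (n * (n + 1)) / 4 - of_int j) * \<theta>))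
   \<le> norm (fourier_coeff (Q n) j)"
proof -
  let ?f = "\<lambda>\<theta>. of_real (cos_prod n \<theta>) * cis ((real (n * (n + 1)) / 4 - of_int j) * \<theta>)"
  have "?f integrable_on {- pi..pi}"
    by (auto intro!: integrable_continuous_interval continuous_intros)
  from integral_linear[OF this bounded_linear_Re]
  have "Re (integral {- pi..pi} ?f) =
      integral {- pi..pi} (\<lambda>\<theta>. cos_prod n \<theta> * cos ((real (n * (n + 1)) / 4 - of_int j) * \<theta>))"
    by (simp add: o_def)
  then have "2 ^ n / (2 * pi) *
     integral {- pi..pi} (\<lambda>\<theta>. cos_prod n \<theta> * cos ((real (n * (n + 1)) / 4 - of_int j) * \<theta>))
     = Re (fourier_coeff (Q n) j)"
    unfolding fourier_coeff_Q by (simp add: Re_complex_of_real)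
  then show ?thesis
    using complex_Re_le_cmod[of "fourier_coeff (Q n) j"] by linarith
qed

section \<open>A majorant for the product\<close>

text \<open>
  The Dirichlet kernel in disguise: \<open>sin\<^sup>2 = (1 - cos (2 \<cdot>)) / 2\<close>, and multiplication by \<open>sin u\<close> makes
  the cosine sum telescope.
\<close>

lemma sum_sin_squares:
  "4 * sin u * (\<Sum>k=1..n. (sin (real k * u))\<^sup>2) = real (2 * n + 1) * sin u - sin (real (2 * n + 1) * u)"
proof (induction n)
  case (Suc n)
  define a where "a = real (Suc n) * u"
  have "real (2 * n + 1) * u = 2 * a - u" "real (2 * Suc n + 1) * u = 2 * a + u"
    by (simp_all add: a_def algebra_simps)
  moreover have "4 * sin u * (sin a)\<^sup>2 = 2 * sin u + sin (2 * a - u) - sin (2 * a + u)"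
    by (simp add: sin_add sin_diff cos_double_sin) (simp add: algebra_simps)
  ultimately show ?case
    using Suc.IH by (simp add: distrib_left a_def[symmetric] del: of_nat_Suc) (simp add: algebra_simps)
qed simp

text \<open>A weak form of Jordan's inequality \<open>sin x \<ge> 2x/\<pi>\<close>, read off from the cubic Taylor bound.\<close>

lemma sin_ge_half:
  assumes "0 \<le> x" "x \<le> pi / 2"
  shows "x / 2 \<le> sin (x::real)"
proof -
  have "x ^ 2 \<le> 3"
  proof -
    have "x \<le> 1.6" using assms pi_approx by simp
    then have "x ^ 2 \<le> 1.6 ^ 2" using assms by (intro power_mono)
    then show ?thesis by (simp add: power2_eq_square)
  qed
  then have "x * x ^ 2 \<le> x * 3" using assms by (intro mult_left_mono)
  moreover have "\<bar>sin x - x\<bar> \<le> x ^ 3 / 6"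
    using Maclaurin_sin_bound[of x 3] assms by (simp add: sin_coeff_def numeral_eq_Suc fact_numeral)
  then have "x - x ^ 3 / 6 \<le> sin x" by linarith
  ultimately show ?thesis by (simp add: power3_eq_cube power2_eq_square)
qed

text \<open>
  Unlike \<open>cos x \<le> exp (-x\<^sup>2/2)\<close>, the bound \<open>|cos x| \<le> exp (-sin\<^sup>2 x / 2)\<close> holds for every \<open>x\<close>, so it
  remains usable when the arguments \<open>k\<theta>/2\<close> wrap around the circle.
\<close>

lemma abs_cos_prod_le_exp:
  "\<bar>cos_prod n \<theta>\<bar> \<le> exp (- (\<Sum>k=1..n. (sin (real k * (\<theta> / 2)))\<^sup>2) / 2)"
proof -
  have "\<bar>cos x\<bar> \<le> exp (- (sin x)\<^sup>2 / 2)" for x :: real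
  proof -
    have "\<bar>cos x\<bar>\<^sup>2 = 1 + - (sin x)\<^sup>2" by (simp add: cos_squared_eq)
    also have "\<dots> \<le> exp (- (sin x)\<^sup>2)" by (rule exp_ge_add_one_self)
    also have "\<dots> = (exp (- (sin x)\<^sup>2 / 2))\<^sup>2" by (simp add: exp_double[symmetric])
    finally show ?thesis by (rule power2_le_imp_le) simp
  qed
  then have "\<bar>cos_prod n \<theta>\<bar> \<le> (\<Prod>k=1..n. exp (- (sin (real k * \<theta> / 2))\<^sup>2 / 2))"
    unfolding cos_prod_def abs_prod by (intro prod_mono) auto
  also have "\<dots> = exp (\<Sum>k=1..n. - (sin (real k * \<theta> / 2))\<^sup>2 / 2)" by (simp add: exp_sum)
  finally show ?thesis by (simp add: sum_divide_distrib sum_negf)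
qed

lemma sum_squares_ge: "real n ^ 3 / 3 \<le> (\<Sum>k=1..n. (real k)\<^sup>2)"
  by (induction n) (simp_all add: power3_eq_cube power2_eq_square algebra_simps)

text \<open>
  Here all the arguments \<open>k\<theta>/2\<close> stay in \<open>[0, \<pi>/2]\<close>, where the sine is bounded below linearly, and
  the sum of squares produces the Gaussian decay.
\<close>

lemma abs_cos_prod_central:
  assumes "0 \<le> \<theta>" "real n * \<theta> \<le> pi"
  shows "\<bar>cos_prod n \<theta>\<bar> \<le> exp (- (real n ^ 3 * \<theta>\<^sup>2) / 96)"
proof -
  have "real n ^ 3 / 3 * (\<theta>\<^sup>2 / 16) \<le> (\<Sum>k=1..n. (real k)\<^sup>2) * (\<theta>\<^sup>2 / 16)"
    by (intro mult_right_mono sum_squares_ge) auto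
  also have "\<dots> = (\<Sum>k=1..n. (real k * (\<theta> / 2) / 2)\<^sup>2)"
    by (simp add: sum_distrib_right power_mult_distrib power_divide)
  also have "\<dots> \<le> (\<Sum>k=1..n. (sin (real k * (\<theta> / 2)))\<^sup>2)"
  proof (intro sum_mono power_mono sin_ge_half)
    fix k assume "k \<in> {1..n}"
    then have "real k * \<theta> \<le> real n * \<theta>" using assms by (intro mult_right_mono) auto
    then show "real k * (\<theta> / 2) \<le> pi / 2" using assms by simp
  qed (use assms in auto)
  finally have "- (\<Sum>k=1..n. (sin (real k * (\<theta> / 2)))\<^sup>2) / 2 \<le> - (real n ^ 3 * \<theta>\<^sup>2) / 96"
    by linarith
  then show ?thesis
    by (intro order_trans[OF abs_cos_prod_le_exp]) (simp only: exp_le_cancel_iff)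
qed

text \<open>
  Once \<open>n\<theta>\<close> exceeds \<open>\<pi>\<close>, the arguments are spread out enough for \<open>sin\<^sup>2 (k\<theta>/2)\<close> to have a positive
  average: the main term of the closed form for the sum is \<open>n/2\<close>, and the error
  \<open>1 / (4 sin (\<theta>/2))\<close> is at most \<open>n/3\<close>.
\<close>

lemma abs_cos_prod_outer:
  assumes "pi \<le> real n * \<theta>" "0 \<le> \<theta>" "\<theta> \<le> pi"
  shows "\<bar>cos_prod n \<theta>\<bar> \<le> exp (- real n / 12)"
proof -
  define S where "S = (\<Sum>k=1..n. (sin (real k * (\<theta> / 2)))\<^sup>2)"
  have n: "n > 0" using assms pi_gt_zero by (cases n) auto
  have "3 / 4 \<le> real n * (\<theta> / 2 / 2)" using assms pi_gt3 by simp
  also have "\<dots> \<le> real n * sin (\<theta> / 2)"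
    using sin_ge_half[of "\<theta> / 2"] assms by (intro mult_left_mono) auto
  finally have s: "1 \<le> 4 * real n / 3 * sin (\<theta> / 2)" by simp
  then have pos: "sin (\<theta> / 2) > 0"
    using n by (smt (verit) divide_nonneg_nonneg mult_nonneg_nonpos of_nat_0_le_iff)
  have "4 * sin (\<theta> / 2) * S \<ge> real (2 * n + 1) * sin (\<theta> / 2) - 1"
    unfolding S_def sum_sin_squares by simp
  then have "sin (\<theta> / 2) * (4 * S) \<ge> sin (\<theta> / 2) * (real (2 * n + 1) - 4 * real n / 3)"
    using s by (simp add: algebra_simps)
  then have "4 * S \<ge> real (2 * n + 1) - 4 * real n / 3"
    using pos by simp
  then have "S \<ge> real n / 6" by simp
  then show ?thesis
    by (intro order_trans[OF abs_cos_prod_le_exp]) (simp add: S_def)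
qed

lemma cos_prod_minus: "cos_prod n (- \<theta>) = cos_prod n \<theta>"
  by (simp add: cos_prod_def)

text \<open>
  A single majorant for both regimes. A Gaussian could not dominate the outer bound \<open>exp (-n/12)\<close>, but
  quadratic decay can, since \<open>1 + n\<^sup>3\<theta>\<^sup>2\<close> is at most a multiple of \<open>n\<^sup>3\<close> on \<open>[-\<pi>, \<pi>]\<close>, and it is
  still integrable. The constant is not optimised.
\<close>

lemma abs_cos_prod_le:
  assumes "n > 0" "\<bar>\<theta>\<bar> \<le> pi"
  shows "\<bar>cos_prod n \<theta>\<bar> \<le> 1000000 / (1 + real n ^ 3 * \<theta>\<^sup>2)"
proof -
  have nonneg: "\<bar>cos_prod n \<theta>\<bar> \<le> 1000000 / (1 + real n ^ 3 * \<theta>\<^sup>2)"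
    if \<theta>: "0 \<le> \<theta>" "\<theta> \<le> pi" for \<theta>
  proof -
    define y where "y = real n ^ 3 * \<theta>\<^sup>2"
    have y: "y \<ge> 0" by (simp add: y_def)
    show ?thesis
    proof (cases "real n * \<theta> \<le> pi")
      case True
      have "exp (- y / 96) = 1 / exp (y / 96)" by (simp add: exp_minus inverse_eq_divide)
      also have "\<dots> \<le> 1 / (1 + y / 96)"
        using y exp_ge_add_one_self[of "y / 96"] by (intro divide_left_mono) auto
      also have "\<dots> \<le> 1000000 / (1 + y)" using y by (simp add: field_simps)
      finally show ?thesis
        using abs_cos_prod_central[OF \<theta>(1) True] by (simp add: y_def)
    next
      case False
      have "\<theta>\<^sup>2 \<le> 4\<^sup>2" using \<theta> pi_less_4 by (intro power_mono) auto
      then have "y \<le> real n ^ 3 * 16" unfolding y_def by (intro mult_left_mono) auto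
      moreover have "1 \<le> real n ^ 3" using assms by simp
      ultimately have "1 + y \<le> 17 * real n ^ 3" by simp
      also have "real n ^ 3 \<le> 46656 * exp (real n / 12)"
      proof -
        \<comment> \<open>The cube of \<open>x \<le> e\<^sup>x\<close> at \<open>x = n/36\<close>; the constant is \<open>36\<^sup>3\<close>.\<close>
        have "(real n / 36) ^ 3 \<le> exp (real n / 36) ^ 3"
          using exp_ge_add_one_self[of "real n / 36"] by (intro power_mono) linarith+
        also have "\<dots> = exp (real n / 12)" by (simp add: exp_of_nat_mult[symmetric])
        finally show ?thesis by (simp add: power_divide)
      qed
      finally have "1 + y \<le> 1000000 * exp (real n / 12)"
        using exp_gt_zero[of "real n / 12"] by linarith
      then have "exp (- real n / 12) \<le> 1000000 / (1 + y)"
        using y by (simp add: exp_minus field_simps)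
      then show ?thesis
        using abs_cos_prod_outer[of n \<theta>] False \<theta> by (simp add: y_def)
    qed
  qed
  show ?thesis
    using nonneg[of "\<bar>\<theta>\<bar>"] assms cos_prod_minus[of n \<theta>] by (cases "\<theta> \<ge> 0") auto
qed

section \<open>The Gaussian limit\<close>

text \<open>
  Both functions agree with \<open>1 - x\<^sup>2/2\<close> up to a multiple of \<open>x\<^sup>4\<close>. The fourth order matters: at the
  scale of interest the arguments are of size \<open>n\<close> to the power \<open>-1/2\<close>, so that \<open>n\<close> errors of order
  \<open>x\<^sup>4\<close> still add up to \<open>O(1/n)\<close>.
\<close>

lemma abs_cos_minus_exp_le: "\<bar>cos x - exp (- x\<^sup>2 / 2)\<bar> \<le> x ^ 4" for x :: real
proof -
  have "\<bar>cos x - (1 - x\<^sup>2 / 2)\<bar> \<le> x ^ 4 / 24"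
  proof -
    obtain t where "cos x = (\<Sum>m<4. cos_coeff m * x ^ m) + cos (t + 1 / 2 * real 4 * pi) / fact 4 * x ^ 4"
      using Maclaurin_cos_expansion[of x 4] by blast
    moreover have "{..<4} = {0, 1, 2, 3 :: nat}" by auto
    ultimately have "cos x - (1 - x\<^sup>2 / 2) = cos (t + 2 * pi) / 24 * x ^ 4"
      by (simp add: cos_coeff_def fact_numeral)
    then have "\<bar>cos x - (1 - x\<^sup>2 / 2)\<bar> = \<bar>cos (t + 2 * pi)\<bar> * (x ^ 4 / 24)"
      by (simp only: abs_mult abs_divide) simp
    also have "\<dots> \<le> 1 * (x ^ 4 / 24)" by (intro mult_right_mono abs_cos_le_one) simp
    finally show ?thesis by simp
  qed
  moreover have "\<bar>exp (- x\<^sup>2 / 2) - (1 - x\<^sup>2 / 2)\<bar> \<le> x ^ 4 / 8"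
  proof -
    define y where "y = x\<^sup>2 / 2"
    have y: "y \<ge> 0" by (simp add: y_def)
    have "1 \<le> (1 - y + y\<^sup>2 / 2) * (1 + y + y\<^sup>2 / 2)"
    proof -
      have "(1 - y + y\<^sup>2 / 2) * (1 + y + y\<^sup>2 / 2) = 1 + (y\<^sup>2)\<^sup>2 / 4"
        by (simp add: power2_eq_square field_simps)
      then show ?thesis by simp
    qed
    also have "\<dots> \<le> (1 - y + y\<^sup>2 / 2) * exp y"
    proof (rule mult_left_mono[OF exp_lower_Taylor_quadratic[OF y]])
      have "(1 - y)\<^sup>2 \<ge> 0" by simp
      then show "0 \<le> 1 - y + y\<^sup>2 / 2" by (simp add: power2_eq_square algebra_simps)
    qed
    finally have "exp (- y) \<le> 1 - y + y\<^sup>2 / 2" by (simp add: exp_minus field_simps)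
    moreover have "1 - y \<le> exp (- y)" using exp_ge_add_one_self[of "- y"] by simp
    ultimately have "\<bar>exp (- y) - (1 - y)\<bar> \<le> y\<^sup>2 / 2"
      using zero_le_power2[of y] by linarith
    then show ?thesis by (simp add: y_def power_divide)
  qed
  moreover have "x ^ 4 \<ge> 0" by simp
  ultimately show ?thesis by linarith
qed

lemma sum_squares_tendsto: "(\<lambda>n. (\<Sum>k=1..n. (real k)\<^sup>2) / real n ^ 3) \<longlonglongrightarrow> 1 / 3"
proof -
  have closed_form: "(\<Sum>k=1..n. (real k)\<^sup>2) = real n * (real n + 1) * (2 * real n + 1) / 6" for n
    by (induction n) (simp_all add: field_simps power2_eq_square)
  show ?thesis
    unfolding closed_form by real_asymp
qed

lemma scale_squared: "n > 0 \<Longrightarrow> (real n powr (- 3 / 2))\<^sup>2 = 1 / real n ^ 3"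
  using powr_add[of "real n" "- 3 / 2" "- 3 / 2"]
  by (simp add: power2_eq_square powr_minus_divide)

text \<open>
  The product of cosines is compared factor by factor with \<open>exp (-(k\<theta>/2)\<^sup>2/2)\<close>: since all factors are
  at most \<open>1\<close> in absolute value, the difference of the products is at most the sum of the
  differences. The product of the exponentials is explicit.
\<close>

lemma cos_prod_tendsto:
  "(\<lambda>n. cos_prod n (t * real n powr (- 3 / 2))) \<longlonglongrightarrow> exp (- t\<^sup>2 / 24)"
proof -
  define x where "x n k = real k * (t * real n powr (- 3 / 2)) / 2" for n k :: nat
  define g where "g n = (\<Prod>k=1..n. exp (- (x n k)\<^sup>2 / 2))" for n
  have "(\<lambda>n. exp (- (t\<^sup>2 / 8) * ((\<Sum>k=1..n. (real k)\<^sup>2) / real n ^ 3))) \<longlonglongrightarrow> exp (- (t\<^sup>2 / 8) * (1 / 3))"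
    by (intro tendsto_intros sum_squares_tendsto)
  moreover have "\<forall>\<^sub>F n in sequentially. exp (- (t\<^sup>2 / 8) * ((\<Sum>k=1..n. (real k)\<^sup>2) / real n ^ 3)) = g n"
    using eventually_gt_at_top[of 0]
  proof eventually_elim
    case (elim n)
    have "- (x n k)\<^sup>2 / 2 = - (t\<^sup>2 / 8) * ((real k)\<^sup>2 / real n ^ 3)" for k
      unfolding x_def power_mult_distrib power_divide scale_squared[OF elim] by simp
    then show ?case
      by (simp add: g_def exp_sum[symmetric] sum_distrib_left sum_divide_distrib)
  qed
  ultimately have g: "g \<longlonglongrightarrow> exp (- t\<^sup>2 / 24)"
    using Lim_transform_eventually by fastforce
  have "(\<lambda>n. cos_prod n (t * real n powr (- 3 / 2)) - g n) \<longlonglongrightarrow> 0"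
  proof (rule Lim_null_comparison)
    show "(\<lambda>n. t ^ 4 / 16 * (1 / real n)) \<longlonglongrightarrow> 0" by real_asymp
    show "\<forall>\<^sub>F n in sequentially. norm (cos_prod n (t * real n powr (- 3 / 2)) - g n) \<le> t ^ 4 / 16 * (1 / real n)"
      using eventually_gt_at_top[of 0]
    proof eventually_elim
      case (elim n)
      have "norm (cos_prod n (t * real n powr (- 3 / 2)) - g n)
          \<le> (\<Sum>k=1..n. norm (cos (x n k) - exp (- (x n k)\<^sup>2 / 2)))"
        unfolding cos_prod_def g_def x_def by (rule norm_prod_diff) auto
      also have "\<dots> \<le> (\<Sum>k=1..n. t ^ 4 / 16 * (1 / real n ^ 2))"
      proof (rule sum_mono)
        fix k assume "k \<in> {1..n}"
        have "norm (cos (x n k) - exp (- (x n k)\<^sup>2 / 2)) \<le> x n k ^ 4"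
          using abs_cos_minus_exp_le by simp
        also have "\<dots> = ((x n k)\<^sup>2)\<^sup>2" by simp
        also have "\<dots> = real k ^ 4 * (t ^ 4 / 16) * (1 / real n ^ 6)"
          unfolding x_def power_mult_distrib power_divide scale_squared[OF elim] by simp
        also have "\<dots> \<le> real n ^ 4 * (t ^ 4 / 16) * (1 / real n ^ 6)"
          using \<open>k \<in> {1..n}\<close> by (intro mult_right_mono power_mono) auto
        also have "\<dots> = t ^ 4 / 16 * (1 / real n ^ 2)"
          using elim by (simp add: field_simps flip: power_add)
        finally show "norm (cos (x n k) - exp (- (x n k)\<^sup>2 / 2)) \<le> t ^ 4 / 16 * (1 / real n ^ 2)" .
      qed
      also have "\<dots> = t ^ 4 / 16 * (1 / real n)" using elim by (simp add: power2_eq_square)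
      finally show ?case .
    qed
  qed
  from tendsto_add[OF this g] show ?thesis by simp
qed

text \<open>The integrand is a multiple of the centred normal density of variance 12.\<close>

lemma integral_gaussian_24: "(\<integral>t. exp (- t\<^sup>2 / 24) \<partial>lborel) = sqrt (24 * pi)"
proof -
  have "(\<integral>t. exp (- t\<^sup>2 / 24) \<partial>lborel) = (\<integral>t. sqrt (24 * pi) * normal_density 0 (sqrt 12) t \<partial>lborel)"
    by (intro Bochner_Integration.integral_cong) (auto simp: normal_density_def)
  also have "\<dots> = sqrt (24 * pi)" by (simp add: integral_normal_density)
  finally show ?thesis .
qed

text \<open>
  Stated for any \<open>h\<close> dominated by the product and with the same rescaled limit, so that it applies both
  to the absolute value of the product (upper bound) and to the product with a slowly oscillating
  factor (lower bound).
\<close>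

lemma rescaled_integral_tendsto:
  fixes h :: "nat \<Rightarrow> real \<Rightarrow> real"
  assumes cont: "\<And>n. continuous_on UNIV (h n)"
    and bound: "\<And>n \<theta>. \<bar>h n \<theta>\<bar> \<le> \<bar>cos_prod n \<theta>\<bar>"
    and lim: "\<And>t. (\<lambda>n. h n (t * real n powr (- 3 / 2))) \<longlonglongrightarrow> exp (- t\<^sup>2 / 24)"
  shows "(\<lambda>n. real n powr (3 / 2) * integral {- pi..pi} (h n)) \<longlonglongrightarrow> sqrt (24 * pi)"
proof -
  define F where "F n t = indicator {- pi..pi} (t * real n powr (- 3 / 2)) *\<^sub>R h n (t * real n powr (- 3 / 2))"
    for n t
  have meas [measurable]: "h n \<in> borel_measurable borel" for n
    by (rule borel_measurable_continuous_onI[OF cont])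
  \<comment> \<open>The shift to \<open>Suc n\<close> avoids \<open>n = 0\<close>, where the scale is \<open>0 powr (- 3 / 2) = 0\<close>.\<close>
  have "(\<lambda>n. \<integral>t. F (Suc n) t \<partial>lborel) \<longlonglongrightarrow> (\<integral>t. exp (- t\<^sup>2 / 24) \<partial>lborel)"
  proof (rule integral_dominated_convergence)
    show "integrable lborel (\<lambda>t. 1000000 * inverse (1 + t\<^sup>2) :: real)"
      using integrable_inverse_1_plus_square
      by (intro integrable_mult_right) (simp add: set_integrable_def)
    show "AE t in lborel. (\<lambda>n. F (Suc n) t) \<longlonglongrightarrow> exp (- t\<^sup>2 / 24)"
    proof (rule AE_I2)
      fix t :: real
      have "(\<lambda>n. t * real n powr (- 3 / 2)) \<longlonglongrightarrow> 0" by real_asymp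
      then have "\<forall>\<^sub>F n in sequentially. t * real n powr (- 3 / 2) \<in> {- pi<..<pi}"
        by (rule topological_tendstoD) auto
      then have "\<forall>\<^sub>F n in sequentially. h n (t * real n powr (- 3 / 2)) = F n t"
        by eventually_elim (auto simp: F_def)
      then have "(\<lambda>n. F n t) \<longlonglongrightarrow> exp (- t\<^sup>2 / 24)"
        by (rule Lim_transform_eventually[OF lim])
      then show "(\<lambda>n. F (Suc n) t) \<longlonglongrightarrow> exp (- t\<^sup>2 / 24)" by (rule LIMSEQ_Suc)
    qed
    show "AE t in lborel. norm (F (Suc n) t) \<le> 1000000 * inverse (1 + t\<^sup>2)" for n
    proof (rule AE_I2)
      fix t :: real
      define \<theta> where "\<theta> = t * real (Suc n) powr (- 3 / 2)"
      have F_eq: "F (Suc n) t = indicator {- pi..pi} \<theta> *\<^sub>R h (Suc n) \<theta>"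
        by (simp only: F_def \<theta>_def)
      show "norm (F (Suc n) t) \<le> 1000000 * inverse (1 + t\<^sup>2)"
      proof (cases "\<bar>\<theta>\<bar> \<le> pi")
        case True
        have rescale: "real (Suc n) ^ 3 * \<theta>\<^sup>2 = t\<^sup>2"
          unfolding \<theta>_def power_mult_distrib scale_squared[OF zero_less_Suc] by (simp del: of_nat_Suc)
        have "\<bar>h (Suc n) \<theta>\<bar> \<le> 1000000 / (1 + t\<^sup>2)"
          using order_trans[OF bound abs_cos_prod_le[OF zero_less_Suc True], of n]
          unfolding rescale .
        then show ?thesis
          using True unfolding F_eq by (simp add: divide_inverse abs_le_iff)
      next
        case False
        then have "\<theta> \<notin> {- pi..pi}" by auto
        then show ?thesis unfolding F_eq by simp
      qed
    qed
  qed (unfold F_def, measurable)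
  moreover have "(\<integral>t. F (Suc n) t \<partial>lborel) = real (Suc n) powr (3 / 2) * integral {- pi..pi} (h (Suc n))" for n
  proof -
    define m where "m = Suc n"
    have m: "m > 0" by (simp add: m_def)
    have "set_integrable lborel {- pi..pi} (h m)"
      by (intro borel_integrable_atLeastAtMost' continuous_on_subset[OF cont]) auto
    then have "integral {- pi..pi} (h m) = (\<integral>\<theta>. indicator {- pi..pi} \<theta> *\<^sub>R h m \<theta> \<partial>lborel)"
      using set_borel_integral_eq_integral(2) unfolding set_lebesgue_integral_def by metis
    also have "\<dots> = real m powr (- 3 / 2) * (\<integral>t. F m t \<partial>lborel)"
      using m lborel_integral_real_affine[of "real m powr (- 3 / 2)" "\<lambda>\<theta>. indicator {- pi..pi} \<theta> *\<^sub>R h m \<theta>" 0]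
      by (simp add: F_def mult.commute)
    finally show ?thesis
      using m by (simp add: m_def[symmetric] powr_minus)
  qed
  ultimately have "(\<lambda>n. real (Suc n) powr (3 / 2) * integral {- pi..pi} (h (Suc n))) \<longlonglongrightarrow> sqrt (24 * pi)"
    by (simp only: integral_gaussian_24)
  then show ?thesis by (rule LIMSEQ_imp_Suc)
qed

lemma rescaled_integral_asymp_equiv:
  assumes "(\<lambda>n. real n powr (3 / 2) * I n) \<longlonglongrightarrow> sqrt (24 * pi)"
  shows "(\<lambda>n. 2 ^ n / (2 * pi) * I n) \<sim>[sequentially] (\<lambda>n. 2 ^ n * sqrt (6 / pi) * real n powr (- 3 / 2))"
proof (rule asymp_equivI')
  have c: "sqrt (24 * pi) / (2 * pi * sqrt (6 / pi)) = 1"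
  proof -
    have "sqrt (24 * pi) = 2 * pi * sqrt (6 / pi)"
      by (rule real_sqrt_unique) (simp_all add: power_mult_distrib power2_eq_square)
    then show ?thesis by simp
  qed
  have "(\<lambda>n. (real n powr (3 / 2) * I n) / (2 * pi * sqrt (6 / pi))) \<longlonglongrightarrow> 1"
    using tendsto_divide[OF assms tendsto_const, of "2 * pi * sqrt (6 / pi)"] c by simp
  then show "(\<lambda>n. (2 ^ n / (2 * pi) * I n) / (2 ^ n * sqrt (6 / pi) * real n powr (- 3 / 2))) \<longlonglongrightarrow> 1"
    by (simp add: powr_minus field_simps)
qed

section \<open>The maximal coefficient\<close>

theorem theorem7:
  shows "(\<lambda>n. sup_norm (fourier_coeff (Q n))) \<sim>[sequentially]
           (\<lambda>n. 2 ^ n * sqrt (6 / pi) * real n powr (- 3 / 2))"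
proof (rule asymp_equiv_sandwich_real)
  \<comment> \<open>The distance from the mean \<open>n(n+1)/4\<close> down to the nearest integer index.\<close>
  define \<delta> where "\<delta> n = frac (real (n * (n + 1)) / 4)" for n
  have \<delta>: "\<bar>\<delta> n\<bar> \<le> 1" for n
    unfolding \<delta>_def by (simp only: abs_of_nonneg[OF frac_ge_0] less_imp_le[OF frac_lt_1])
  let ?L = "\<lambda>n. integral {- pi..pi} (\<lambda>\<theta>. cos_prod n \<theta> * cos (\<delta> n * \<theta>))"
  let ?U = "\<lambda>n. integral {- pi..pi} (\<lambda>\<theta>. \<bar>cos_prod n \<theta>\<bar>)"
  have "(\<lambda>n. real n powr (3 / 2) * ?L n) \<longlonglongrightarrow> sqrt (24 * pi)"
  proof (rule rescaled_integral_tendsto)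
    show "continuous_on UNIV (\<lambda>\<theta>. cos_prod n \<theta> * cos (\<delta> n * \<theta>))" for n
      by (intro continuous_intros)
    show "\<bar>cos_prod n \<theta> * cos (\<delta> n * \<theta>)\<bar> \<le> \<bar>cos_prod n \<theta>\<bar>" for n \<theta>
      unfolding abs_mult by (rule mult_left_le) auto
    fix t :: real
    have "(\<lambda>n. \<delta> n * (t * real n powr (- 3 / 2))) \<longlonglongrightarrow> 0"
    proof (rule Lim_null_comparison)
      show "(\<lambda>n. \<bar>t\<bar> * real n powr (- 3 / 2)) \<longlonglongrightarrow> 0" by real_asymp
      have "\<bar>\<delta> n\<bar> * (\<bar>t\<bar> * real n powr (- 3 / 2)) \<le> 1 * (\<bar>t\<bar> * real n powr (- 3 / 2))" for n
        by (intro mult_right_mono \<delta>) auto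
      then show "\<forall>\<^sub>F n in sequentially. norm (\<delta> n * (t * real n powr (- 3 / 2))) \<le> \<bar>t\<bar> * real n powr (- 3 / 2)"
        by (auto simp: abs_mult)
    qed
    from tendsto_mult[OF cos_prod_tendsto tendsto_cos[OF this], of t]
    show "(\<lambda>n. cos_prod n (t * real n powr (- 3 / 2)) * cos (\<delta> n * (t * real n powr (- 3 / 2))))
        \<longlonglongrightarrow> exp (- t\<^sup>2 / 24)" by simp
  qed
  then show "(\<lambda>n. 2 ^ n / (2 * pi) * ?L n) \<sim>[sequentially] (\<lambda>n. 2 ^ n * sqrt (6 / pi) * real n powr (- 3 / 2))"
    by (rule rescaled_integral_asymp_equiv)
  have "(\<lambda>n. real n powr (3 / 2) * ?U n) \<longlonglongrightarrow> sqrt (24 * pi)"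
  proof (rule rescaled_integral_tendsto)
    show "continuous_on UNIV (\<lambda>\<theta>. \<bar>cos_prod n \<theta>\<bar>)" for n
      by (intro continuous_intros)
    show "(\<lambda>n. \<bar>cos_prod n (t * real n powr (- 3 / 2))\<bar>) \<longlonglongrightarrow> exp (- t\<^sup>2 / 24)" for t
      using tendsto_rabs[OF cos_prod_tendsto, of t] by simp
  qed simp
  then show "(\<lambda>n. 2 ^ n / (2 * pi) * ?U n) \<sim>[sequentially] (\<lambda>n. 2 ^ n * sqrt (6 / pi) * real n powr (- 3 / 2))"
    by (rule rescaled_integral_asymp_equiv)
  have "2 ^ n / (2 * pi) * ?L n \<le> sup_norm (fourier_coeff (Q n))" for n
  proof -
    have "2 ^ n / (2 * pi) * ?L n \<le> norm (fourier_coeff (Q n) \<lfloor>real (n * (n + 1)) / 4\<rfloor>)"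
      using norm_fourier_coeff_Q_ge[of n "\<lfloor>real (n * (n + 1)) / 4\<rfloor>"] by (simp add: \<delta>_def frac_def)
    also have "\<dots> \<le> sup_norm (fourier_coeff (Q n))"
      unfolding sup_norm_def by (rule cSUP_upper[OF _ bdd_above_fourier_coeff_Q]) simp
    finally show ?thesis .
  qed
  moreover have "sup_norm (fourier_coeff (Q n)) \<le> 2 ^ n / (2 * pi) * ?U n" for n
    unfolding sup_norm_def by (intro cSUP_least norm_fourier_coeff_Q_le) simp
  ultimately show "\<forall>\<^sub>F n in sequentially. sup_norm (fourier_coeff (Q n))
      \<in> {2 ^ n / (2 * pi) * ?L n..2 ^ n / (2 * pi) * ?U n}"
    by simp
qed

end
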